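(* Let $H_0$ be a Hermitian operator on a finite-dimensional Hilbert space with ground-space projection $P_0$, $Q_0=I-P_0$, ground energy $E_0$, $G=Q_0(E_0I-H_0)^{-1}Q_0$, and $V$ Hermitian. Suppose $L$ is an integer with $P_0\Gamma(n)P_0\subseteq\mathbb{C}P_0$ for all $n<L$. Then for any $k\ge1$ and integers $n_1,\dots,n_{2k}\in\mathbb{N}$ with $\sum_{j=1}^{2k}n_j<L$, and any $T_{n_j}\in\Gamma^\star(n_j)$, $j=1,\dots,2k$, we have $T_{n_1}\cdots T_{n_{2k}}P_0\in\mathbb{C}P_0$ and $P_0T_{n_1}\cdots T_{n_{2k}}\in\mathbb{C}P_0$.
   Context: $\Gamma(n)$ is the linear span of operators $Z_0VZ_1V\cdots Z_{n-1}VZ_n$ ($n$ factors of $V$) with each $Z_j\in\{P_0,Q_0\}\cup\{G^m:m\in\mathbb{N}\}$; $\Gamma^\star(n)\subseteq\Gamma(n)$ is the span of such products that additionally satisfy $Z_0Z_n=Z_nZ_0=0$. *)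

theory Defs
  imports "HOL-Analysis.Analysis"
begin

type_synonym 'n cmat = "complex ^ 'n ^ 'n"

text \<open>Operators on the finite-dimensional Hilbert space C^n are n x n complex matrices.\<close>

definition adjoint_mat :: "'n::finite cmat \<Rightarrow> 'n cmat" where
  "adjoint_mat A = (\<chi> i j. cnj (A $ j $ i))"

definition hermitian :: "'n::finite cmat \<Rightarrow> bool" where
  "hermitian A \<longleftrightarrow> adjoint_mat A = A"

definition cscale :: "complex \<Rightarrow> 'n::finite cmat \<Rightarrow> 'n cmat" where
  "cscale c A = (\<chi> i j. c * A $ i $ j)"

definition is_eigenvalue :: "'n::finite cmat \<Rightarrow> complex \<Rightarrow> bool" where
  "is_eigenvalue A c \<longleftrightarrow> (\<exists>v. v \<noteq> 0 \<and> A *v v = c *s v)"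

text \<open>Ground energy: the smallest eigenvalue of a Hermitian operator.\<close>
definition ground_energy :: "'n::finite cmat \<Rightarrow> real" where
  "ground_energy H = (THE e. is_eigenvalue H (complex_of_real e) \<and>
      (\<forall>c. is_eigenvalue H c \<longrightarrow> e \<le> Re c))"

text \<open>Orthogonal projection onto the ground space (eigenspace of the ground energy).\<close>
definition ground_proj :: "'n::finite cmat \<Rightarrow> 'n cmat" where
  "ground_proj H = (THE P. hermitian P \<and> P ** P = P \<and>
      range (\<lambda>x. P *v x) = {v. H *v v = complex_of_real (ground_energy H) *s v})"

definition excited_proj :: "'n::finite cmat \<Rightarrow> 'n cmat" where
  "excited_proj H = mat 1 - ground_proj H"

text \<open>Reduced resolvent G = Q0 (E0 I - H0)^{-1} Q0, where the inverse is taken on the range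
  of Q0 (on which E0 I - H0 is invertible) and G vanishes on the ground space.\<close>
definition reduced_resolvent :: "'n::finite cmat \<Rightarrow> 'n cmat" where
  "reduced_resolvent H = (THE G.
      G ** (mat (complex_of_real (ground_energy H)) - H) = excited_proj H \<and>
      G ** ground_proj H = 0 \<and> ground_proj H ** G = 0)"

fun mpow :: "'n::finite cmat \<Rightarrow> nat \<Rightarrow> 'n cmat" where
  "mpow A 0 = mat 1"
| "mpow A (Suc m) = A ** mpow A m"

text \<open>Z_0 V Z_1 V ... V Z_n for the list [Z_0,...,Z_n].\<close>
fun word_prod :: "'n::finite cmat \<Rightarrow> 'n cmat list \<Rightarrow> 'n cmat" where
  "word_prod V [] = mat 1"
| "word_prod V [Z] = Z"
| "word_prod V (Z # Zs) = Z ** V ** word_prod V Zs"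

text \<open>Complex linear span of a set of matrices.\<close>
inductive_set cspan :: "'n::finite cmat set \<Rightarrow> 'n cmat set" for S where
  zero: "0 \<in> cspan S"
| base: "A \<in> S \<Longrightarrow> A \<in> cspan S"
| add: "A \<in> cspan S \<Longrightarrow> B \<in> cspan S \<Longrightarrow> A + B \<in> cspan S"
| scale: "A \<in> cspan S \<Longrightarrow> cscale c A \<in> cspan S"

definition Zset :: "'n::finite cmat \<Rightarrow> 'n cmat set" where
  "Zset H = {ground_proj H, excited_proj H} \<union> {mpow (reduced_resolvent H) m | m. m \<ge> 1}"

definition Gamma :: "'n::finite cmat \<Rightarrow> 'n cmat \<Rightarrow> nat \<Rightarrow> 'n cmat set" where
  "Gamma H V n = cspan {word_prod V Zs | Zs. length Zs = Suc n \<and> set Zs \<subseteq> Zset H}"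

definition Gamma_star :: "'n::finite cmat \<Rightarrow> 'n cmat \<Rightarrow> nat \<Rightarrow> 'n cmat set" where
  "Gamma_star H V n = cspan {word_prod V Zs | Zs. length Zs = Suc n \<and> set Zs \<subseteq> Zset H
      \<and> hd Zs ** last Zs = 0 \<and> last Zs ** hd Zs = 0}"

definition CP0 :: "'n::finite cmat \<Rightarrow> 'n cmat set" where
  "CP0 H = {cscale c (ground_proj H) | c. True}"

end

theory Submission
  imports Defs
begin

text \<open>Every generator of \<open>\<Gamma>\<^sup>\<star>(n)\<close> begins with some \<open>Z\<^sub>0\<close> and ends with some \<open>Z\<^sub>n\<close>, each of which lives
  either in the ground block (\<open>P\<^sub>0\<close>) or in the excited block (\<open>Q\<^sub>0\<close>, \<open>G\<^sup>m\<close>); the condition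
  \<open>Z\<^sub>0 Z\<^sub>n = 0\<close> forces the two ends into different blocks (or their common block to vanish). Hence every \<open>T \<in> \<Gamma>\<^sup>\<star>(n)\<close> is
  block-antidiagonal: \<open>P\<^sub>0 T P\<^sub>0 = Q\<^sub>0 T Q\<^sub>0 = 0\<close>. A product \<open>R\<close> of an even number of such
  operators is block-diagonal, so \<open>R P\<^sub>0 = P\<^sub>0 R P\<^sub>0 = P\<^sub>0 R\<close>. Since the \<open>\<Gamma>(n)\<close> multiply like a graded
  algebra, \<open>R \<in> \<Gamma>(\<Sigma> n\<^sub>j)\<close>, and the hypothesis puts \<open>P\<^sub>0 R P\<^sub>0\<close> in \<open>\<complex>P\<^sub>0\<close>.\<close>

section \<open>Matrix algebra\<close>

lemma matrix_add_rdistrib: "((A::'a::semiring_1^'n^'m) + B) ** C = A ** C + B ** C"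
  by (simp add: matrix_matrix_mult_def vec_eq_iff sum.distrib distrib_right)

lemma matrix_diff_rdistrib: "((A::'a::ring_1^'n^'m) - B) ** C = A ** C - B ** C"
  by (simp add: matrix_matrix_mult_def vec_eq_iff sum_subtractf left_diff_distrib)

lemma matrix_diff_ldistrib: "(C::'a::ring_1^'n^'m) ** (A - B) = C ** A - C ** B"
  by (simp add: matrix_matrix_mult_def vec_eq_iff sum_subtractf right_diff_distrib)

lemma mat_matrix_vector_mult: "(mat c :: 'a::semiring_1^'n::finite^'n) *v x = c *s x"
  by (simp add: vec_eq_iff matrix_vector_mult_def mat_def if_distribR if_distrib[of "\<lambda>z. z * _"]
      cong: if_cong)

lemma cscale_matrix_mult_left: "cscale c A ** B = cscale c (A ** (B::'n::finite cmat))"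
  by (simp add: cscale_def matrix_matrix_mult_def vec_eq_iff sum_distrib_left mult.assoc)

lemma cscale_matrix_mult_right: "A ** cscale c B = cscale c (A ** (B::'n::finite cmat))"
  by (simp add: cscale_def matrix_matrix_mult_def vec_eq_iff sum_distrib_left algebra_simps)

lemma cscale_zero: "cscale c (0::'n::finite cmat) = 0"
  by (simp add: cscale_def vec_eq_iff)

lemma adjoint_mat_mult: "adjoint_mat (A ** B) = adjoint_mat B ** adjoint_mat (A::'n::finite cmat)"
  by (simp add: adjoint_mat_def matrix_matrix_mult_def vec_eq_iff mult.commute)

lemma adjoint_mat_zero: "adjoint_mat (0::'n::finite cmat) = 0"
  by (simp add: adjoint_mat_def vec_eq_iff)

lemma hermitian_mat_real_diff:
  "hermitian A \<Longrightarrow> hermitian (mat (complex_of_real e) - A :: 'n::finite cmat)"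
  by (simp add: hermitian_def adjoint_mat_def vec_eq_iff mat_def)

lemma matrix_vector_mult_axis: "((A::'a::semiring_1^'n::finite^'m) *v axis j 1) $ i = A $ i $ j"
  by (simp add: matrix_vector_mult_def axis_def if_distrib cong: if_cong)

lemma mpow_Suc_right: "mpow A (Suc m) = mpow A m ** A"
  by (induction m) (simp_all add: matrix_mul_assoc)

lemma mpow_add: "mpow A (a + b) = mpow A a ** mpow A b"
  by (induction a) (simp_all add: matrix_mul_assoc)

section \<open>Block structure with respect to a projection\<close>

definition block_diagonal :: "'a::ring_1^'n::finite^'n \<Rightarrow> 'a^'n^'n \<Rightarrow> bool" where
  "block_diagonal P A \<longleftrightarrow> P ** A ** (mat 1 - P) = 0 \<and> (mat 1 - P) ** A ** P = 0"

definition block_antidiagonal :: "'a::ring_1^'n::finite^'n \<Rightarrow> 'a^'n^'n \<Rightarrow> bool" where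
  "block_antidiagonal P A \<longleftrightarrow> P ** A ** P = 0 \<and> (mat 1 - P) ** A ** (mat 1 - P) = 0"

lemma idempotent_complement:
  "P ** P = P \<Longrightarrow> (mat 1 - P) ** (mat 1 - P) = (mat 1 - P :: 'a::ring_1^'n::finite^'n)"
  by (simp add: matrix_diff_ldistrib matrix_diff_rdistrib)

lemma matrix_mult_split_by_projection:
  fixes P :: "'a::ring_1^'n::finite^'n"
  assumes "P ** P = P"
  shows "X ** (A ** B) ** Y
    = (X ** A ** P) ** (P ** B ** Y) + (X ** A ** (mat 1 - P)) ** ((mat 1 - P) ** B ** Y)"
proof -
  have "X ** (A ** B) ** Y = X ** A ** (P + (mat 1 - P)) ** B ** Y"
    by (simp add: matrix_mul_assoc)
  also have "\<dots> = X ** A ** (P ** P) ** B ** Y + X ** A ** ((mat 1 - P) ** (mat 1 - P)) ** B ** Y"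
    by (simp only: assms idempotent_complement[OF assms] matrix_add_ldistrib matrix_add_rdistrib)
  also have "\<dots> = (X ** A ** P) ** (P ** B ** Y) + (X ** A ** (mat 1 - P)) ** ((mat 1 - P) ** B ** Y)"
    by (simp add: matrix_mul_assoc)
  finally show ?thesis .
qed

lemma block_antidiagonal_mult:
  "P ** P = P \<Longrightarrow> block_antidiagonal P A \<Longrightarrow> block_antidiagonal P B \<Longrightarrow> block_diagonal P (A ** B)"
  by (simp add: block_diagonal_def block_antidiagonal_def matrix_mult_split_by_projection
      idempotent_complement)

lemma block_antidiagonal_diagonal_mult:
  "P ** P = P \<Longrightarrow> block_antidiagonal P A \<Longrightarrow> block_diagonal P B \<Longrightarrow> block_antidiagonal P (A ** B)"
  by (simp add: block_diagonal_def block_antidiagonal_def matrix_mult_split_by_projection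
      idempotent_complement)

lemma block_diagonal_mat_1: "P ** P = P \<Longrightarrow> block_diagonal P (mat 1)"
  by (simp add: block_diagonal_def matrix_diff_ldistrib matrix_diff_rdistrib)

lemma block_antidiagonal_foldr_mult:
  fixes P :: "'a::ring_1^'n::finite^'n"
  assumes "P ** P = P" and "\<forall>A \<in> set As. block_antidiagonal P A"
  shows "(even (length As) \<longrightarrow> block_diagonal P (foldr (**) As (mat 1)))
    \<and> (odd (length As) \<longrightarrow> block_antidiagonal P (foldr (**) As (mat 1)))"
  using assms(2)
  by (induction As)
    (simp_all add: block_diagonal_mat_1 block_antidiagonal_mult block_antidiagonal_diagonal_mult assms(1))

lemma block_diagonal_projection_mult:
  fixes P :: "'a::ring_1^'n::finite^'n"
  assumes "block_diagonal P A"
  shows "A ** P = P ** A ** P" and "P ** A = P ** A ** P"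
proof -
  have "A ** P = (P + (mat 1 - P)) ** A ** P" by simp
  then show "A ** P = P ** A ** P"
    using assms by (simp only: matrix_add_rdistrib block_diagonal_def) simp
  have "P ** A = P ** A ** (P + (mat 1 - P))" by simp
  then show "P ** A = P ** A ** P"
    using assms by (simp only: matrix_add_ldistrib block_diagonal_def) simp
qed

lemma block_antidiagonal_cspan:
  assumes "\<forall>B \<in> S. block_antidiagonal P B" and "A \<in> cspan S"
  shows "block_antidiagonal P A"
  using assms(2)
  by (induction A rule: cspan.induct)
    (use assms(1) in \<open>simp_all add: block_antidiagonal_def matrix_add_ldistrib matrix_add_rdistrib
      cscale_matrix_mult_left cscale_matrix_mult_right cscale_zero\<close>)

section \<open>Orthogonal projections onto complex subspaces\<close>

definition cinner :: "complex^'n::finite \<Rightarrow> complex^'n \<Rightarrow> complex" where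
  "cinner u v = (\<Sum>i\<in>UNIV. u$i * cnj (v$i))"

lemma inner_eq_Re_cinner: "inner u v = Re (cinner u v)"
  by (simp add: inner_vec_def cinner_def inner_complex_def Re_sum)

lemma cinner_scale_left: "cinner (c *s u) v = c * cinner u v"
  by (simp add: cinner_def sum_distrib_left mult.assoc)

lemma cinner_scale_right: "cinner u (c *s v) = cnj c * cinner u v"
  by (simp add: cinner_def sum_distrib_left algebra_simps)

lemma cinner_add_left: "cinner (u + w) v = cinner u v + cinner w v"
  by (simp add: cinner_def sum.distrib algebra_simps)

lemma cinner_diff_left: "cinner (u - w) v = cinner u v - cinner w v"
  by (simp add: cinner_def sum_subtractf algebra_simps)

lemma cinner_diff_right: "cinner u (v - w) = cinner u v - cinner u w"
  by (simp add: cinner_def sum_subtractf algebra_simps)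

lemma cinner_commute: "cinner v u = cnj (cinner u v)"
  by (simp add: cinner_def mult.commute)

lemma cinner_axis: "cinner u (axis i 1) = u $ i"
  by (simp add: cinner_def axis_def if_distrib cong: if_cong)

lemma cinner_self_eq_0: "cinner u u = 0 \<longleftrightarrow> u = 0"
proof
  assume "cinner u u = 0"
  then have "inner u u = 0" by (simp add: inner_eq_Re_cinner)
  then show "u = 0" by simp
qed (simp add: cinner_def)

lemma hermitianI:
  assumes "\<And>x y. cinner (A *v x) y = cinner x (A *v y)"
  shows "hermitian A"
  unfolding hermitian_def adjoint_mat_def vec_eq_iff
proof (intro allI)
  fix i j
  have "A $ i $ j = cinner (A *v axis j 1) (axis i 1)"
    by (simp add: cinner_axis matrix_vector_mult_axis)
  also have "\<dots> = cnj (cinner (A *v axis i 1) (axis j 1))"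
    by (simp add: assms cinner_commute[of "axis j 1"])
  also have "\<dots> = cnj (A $ j $ i)"
    by (simp add: cinner_axis matrix_vector_mult_axis)
  finally show "(\<chi> i j. cnj (A $ j $ i)) $ i $ j = A $ i $ j" by simp
qed

lemma subspace_if_vec_subspace:
  assumes "vec.subspace (S :: (complex^'n::finite) set)"
  shows "subspace S"
proof -
  have "r *\<^sub>R x = complex_of_real r *s x" for r and x :: "complex^'n"
    by (simp add: vec_eq_iff) (simp add: scaleR_conv_of_real)
  then show ?thesis
    using assms by (simp add: subspace_def vec.subspace_def)
qed

text \<open>A complex subspace is closed under multiplication by \<open>\<i>\<close>, so real orthogonality to it
  (the notion of the library) already kills the imaginary part of the complex inner product.\<close>

lemma cinner_eq_0_if_orthogonal:
  assumes "vec.subspace S" and "\<forall>w\<in>S. orthogonal u w" and "w \<in> S"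
  shows "cinner u w = 0"
proof -
  have "\<i> *s w \<in> S" using assms(1,3) by (rule vec.subspace_scale)
  then have "Re (cinner u w) = 0" and "Re (cinner u (\<i> *s w)) = 0"
    using assms(2,3) by (auto simp: orthogonal_def inner_eq_Re_cinner)
  then show ?thesis by (simp add: cinner_scale_right complex_eq_iff)
qed

lemma complex_orthogonal_decomp_exists:
  assumes "vec.subspace S"
  shows "\<exists>y\<in>S. \<forall>w\<in>S. cinner (x - y) w = 0"
proof -
  have "span S = S" using subspace_if_vec_subspace[OF assms] by (simp add: span_eq_iff)
  then obtain y z where "y \<in> S" "\<And>w. w \<in> S \<Longrightarrow> orthogonal z w" "x = y + z"
    using orthogonal_subspace_decomp_exists[of S x] by metis
  then show ?thesis using cinner_eq_0_if_orthogonal[OF assms] by (intro bexI[of _ y]) auto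
qed

lemma complex_orthogonal_decomp_unique:
  assumes S: "vec.subspace S" and "y \<in> S" "y' \<in> S"
    and "\<forall>w\<in>S. cinner (x - y) w = 0" "\<forall>w\<in>S. cinner (x - y') w = 0"
  shows "y = y'"
proof -
  have "y - y' \<in> S" using assms(1-3) by (rule vec.subspace_diff)
  then have "cinner (y - y') (y - y') = cinner (x - y') (y - y') - cinner (x - y) (y - y')"
    by (simp add: cinner_diff_left[symmetric])
  also have "\<dots> = 0" using assms(4,5) \<open>y - y' \<in> S\<close> by simp
  finally show ?thesis by (simp add: cinner_self_eq_0)
qed

lemma hermitian_projection_exists:
  assumes S: "vec.subspace (S :: (complex^'n::finite) set)"
  shows "\<exists>P. hermitian P \<and> P ** P = P \<and> range ((*v) P) = S"
proof -
  define p where "p x = (SOME y. y \<in> S \<and> (\<forall>w\<in>S. cinner (x - y) w = 0))" for x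
  have p: "p x \<in> S" "\<forall>w\<in>S. cinner (x - p x) w = 0" for x
    using someI_ex[OF complex_orthogonal_decomp_exists[OF S, of x, unfolded Bex_def]]
    unfolding p_def by auto
  have p_eqI: "p x = y" if "y \<in> S" "\<forall>w\<in>S. cinner (x - y) w = 0" for x y
    using complex_orthogonal_decomp_unique[OF S p(1) that(1) p(2)] that(2) by simp
  have p_id: "p y = y" if "y \<in> S" for y
    using that by (intro p_eqI) (auto simp: cinner_def)
  have "Vector_Spaces.linear (*s) (*s) p"
    unfolding Vector_Spaces.linear_iff
  proof (intro conjI allI vec.vector_space_axioms)
    fix x y
    have "cinner (x + y - (p x + p y)) w = cinner (x - p x) w + cinner (y - p y) w" for w
      by (simp add: cinner_add_left[symmetric] algebra_simps)
    then show "p (x + y) = p x + p y"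
      using p by (intro p_eqI) (simp_all add: vec.subspace_add[OF S])
  next
    fix c x
    have "cinner (c *s x - c *s p x) w = c * cinner (x - p x) w" for w
      by (simp add: cinner_scale_left[symmetric] vector_ssub_ldistrib)
    then show "p (c *s x) = c *s p x"
      using p by (intro p_eqI) (simp_all add: vec.subspace_scale[OF S])
  qed
  then have Pv: "matrix p *v x = p x" for x by (rule matrix_works)
  have "cinner (p x) y = cinner x (p y)" for x y
  proof -
    have "cinner (p x) (y - p y) = 0"
      using p by (metis cinner_commute complex_cnj_zero)
    moreover have "cinner (x - p x) (p y) = 0" using p by blast
    ultimately show ?thesis by (simp add: cinner_diff_left cinner_diff_right)
  qed
  then have "hermitian (matrix p)" by (intro hermitianI) (simp add: Pv)
  moreover have "matrix p ** matrix p = matrix p"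
    unfolding matrix_eq by (simp add: Pv p p_id flip: matrix_vector_mul_assoc)
  moreover have "range ((*v) (matrix p)) = S"
  proof
    show "range ((*v) (matrix p)) \<subseteq> S" using p(1) by (auto simp: Pv)
    show "S \<subseteq> range ((*v) (matrix p))" by (metis Pv p_id rangeI subsetI)
  qed
  ultimately show ?thesis by blast
qed

lemma hermitian_projection_unique:
  fixes P P' :: "'n::finite cmat"
  assumes "hermitian P" "P ** P = P" "hermitian P'" "P' ** P' = P'"
    and "range ((*v) P) = range ((*v) P')"
  shows "P = P'"
proof -
  have fix_range: "A ** B = B" if idem: "A ** A = A" and rng: "range ((*v) A) = range ((*v) B)"
    for A B :: "'n cmat"
    unfolding matrix_eq
  proof
    fix x
    obtain y where "B *v x = A *v y" using rng by (metis rangeI image_iff)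
    then show "A ** B *v x = B *v x" by (metis idem matrix_vector_mul_assoc)
  qed
  have "P = adjoint_mat (P' ** P)" using fix_range assms by (simp add: hermitian_def)
  also have "\<dots> = P ** P'" using assms by (simp add: adjoint_mat_mult hermitian_def)
  also have "\<dots> = P'" using fix_range assms by simp
  finally show ?thesis .
qed

section \<open>Words and their linear spans\<close>

lemma word_prod_Cons: "Zs \<noteq> [] \<Longrightarrow> word_prod V (Z # Zs) = Z ** V ** word_prod V Zs"
  by (cases Zs) auto

lemma word_prod_eq_0: "0 \<in> set Zs \<Longrightarrow> word_prod V Zs = (0::'n::finite cmat)"
  by (induction V Zs rule: word_prod.induct) auto

lemma word_prod_hd: "Zs \<noteq> [] \<Longrightarrow> \<exists>X. word_prod V Zs = hd Zs ** (X::'n::finite cmat)"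
proof (induction V Zs rule: word_prod.induct)
  case (2 V Z) show ?case by (intro exI[of _ "mat 1"]) simp
next
  case (3 V Z Z' Zs) show ?case by (auto simp: matrix_mul_assoc[symmetric])
qed simp

lemma word_prod_last: "Zs \<noteq> [] \<Longrightarrow> \<exists>Y. word_prod V Zs = (Y::'n::finite cmat) ** last Zs"
proof (induction V Zs rule: word_prod.induct)
  case (2 V Z) show ?case by (intro exI[of _ "mat 1"]) simp
next
  case (3 V Z Z' Zs)
  then obtain Y where "word_prod V (Z' # Zs) = Y ** last (Z' # Zs)" by blast
  then show ?case by (intro exI[of _ "Z ** V ** Y"]) (simp add: matrix_mul_assoc)
qed simp

lemma word_prod_mult:
  assumes "Zs \<noteq> []" and "Ws \<noteq> []"
  shows "word_prod V Zs ** word_prod V Ws = word_prod V (butlast Zs @ (last Zs ** hd Ws) # tl Ws)"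
  using assms(1)
proof (induction Zs)
  case (Cons Z Zs)
  show ?case
  proof (cases "Zs = []")
    case True
    then show ?thesis using assms(2) by (cases Ws; cases "tl Ws") (auto simp: matrix_mul_assoc)
  next
    case False
    then have "word_prod V (Z # Zs) ** word_prod V Ws = Z ** V ** (word_prod V Zs ** word_prod V Ws)"
      by (simp add: word_prod_Cons matrix_mul_assoc)
    also have "\<dots> = Z ** V ** word_prod V (butlast Zs @ (last Zs ** hd Ws) # tl Ws)"
      using Cons.IH False by simp
    finally show ?thesis using False by (simp add: word_prod_Cons)
  qed
qed simp

lemma cspan_mono: "A \<in> cspan S \<Longrightarrow> S \<subseteq> T \<Longrightarrow> A \<in> cspan T"
  by (induction A rule: cspan.induct) (auto intro: cspan.intros)

lemma cspan_mult:
  assumes "\<And>a b. a \<in> S \<Longrightarrow> b \<in> T \<Longrightarrow> a ** b \<in> cspan U"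
    and "A \<in> cspan S" and "B \<in> cspan T"
  shows "A ** B \<in> cspan (U::'n::finite cmat set)"
  using assms(2)
proof (induction A rule: cspan.induct)
  case (base a)
  from assms(3) show ?case
    by (induction B rule: cspan.induct)
      (use assms(1) base in \<open>auto simp: matrix_add_ldistrib cscale_matrix_mult_right intro: cspan.intros\<close>)
qed (auto simp: matrix_add_rdistrib cscale_matrix_mult_left intro: cspan.intros)

lemma Gamma_star_subset_Gamma: "Gamma_star H V n \<subseteq> Gamma H V n"
  unfolding Gamma_star_def Gamma_def by (auto elim: cspan_mono)

section \<open>The operators \<open>P\<^sub>0\<close>, \<open>Q\<^sub>0\<close> and \<open>G\<close> of a Hamiltonian\<close>

locale hamiltonian =
  fixes H :: "'n::finite cmat"
  assumes hermitian_H: "hermitian H"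
begin

abbreviation "P0 \<equiv> ground_proj H"
abbreviation "Q0 \<equiv> excited_proj H"
abbreviation "G \<equiv> reduced_resolvent H"
abbreviation "M \<equiv> mat (complex_of_real (ground_energy H)) - H"

lemma ground_proj:
  shows ground_proj_hermitian: "hermitian P0"
    and ground_proj_idem: "P0 ** P0 = P0"
    and range_ground_proj: "range ((*v) P0) = {v. M *v v = 0}"
proof -
  have eigenspace: "{v. H *v v = complex_of_real (ground_energy H) *s v} = {v. M *v v = 0}"
    by (auto simp: matrix_vector_mult_diff_rdistrib mat_matrix_vector_mult)
  obtain P where P: "hermitian P \<and> P ** P = P \<and> range ((*v) P) = {v. M *v v = 0}"
    using hermitian_projection_exists[OF vec.subspace_kernel] by blast
  moreover have "P' = P" if "hermitian P' \<and> P' ** P' = P' \<and> range ((*v) P') = {v. M *v v = 0}" for P'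
    using hermitian_projection_unique[of P' P] that P by simp
  ultimately have "\<exists>!P. hermitian P \<and> P ** P = P \<and> range ((*v) P) = {v. M *v v = 0}"
    by (intro ex1I[of _ P])
  then have "hermitian P0 \<and> P0 ** P0 = P0 \<and> range ((*v) P0) = {v. M *v v = 0}"
    unfolding ground_proj_def eigenspace by (rule theI')
  then show "hermitian P0" "P0 ** P0 = P0" "range ((*v) P0) = {v. M *v v = 0}" by auto
qed

lemma ground_proj_fixes:
  assumes "M *v v = 0"
  shows "P0 *v v = v"
proof -
  have "v \<in> range ((*v) P0)" using assms range_ground_proj by simp
  then obtain y where "v = P0 *v y" by blast
  then show ?thesis by (simp add: matrix_vector_mul_assoc ground_proj_idem)
qed

lemma M_ground_proj: "M ** P0 = 0"
  unfolding matrix_eq using range_ground_proj by (auto simp flip: matrix_vector_mul_assoc)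

lemma ground_proj_M: "P0 ** M = 0"
proof -
  have "adjoint_mat (M ** P0) = 0" by (simp add: M_ground_proj adjoint_mat_zero)
  then show ?thesis
    using ground_proj_hermitian hermitian_mat_real_diff[OF hermitian_H]
    by (simp add: adjoint_mat_mult hermitian_def)
qed

lemma invertible_M_plus_ground_proj: "invertible (M + P0)"
proof -
  have "x = 0" if "(M + P0) *v x = 0" for x
  proof -
    have "P0 *v x = P0 *v ((M + P0) *v x)"
      by (simp add: matrix_vector_mul_assoc matrix_add_ldistrib ground_proj_M ground_proj_idem)
    then have "P0 *v x = 0" using that by simp
    moreover from this have "M *v x = 0" using that by (simp add: matrix_vector_mult_add_rdistrib)
    ultimately show "x = 0" using ground_proj_fixes by simp
  qed
  then show ?thesis by (simp add: invertible_left_inverse matrix_left_invertible_ker)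
qed

lemma excited_proj:
  shows ground_plus_excited: "P0 + Q0 = mat 1"
    and ground_excited: "P0 ** Q0 = 0"
    and excited_ground: "Q0 ** P0 = 0"
    and excited_proj_idem: "Q0 ** Q0 = Q0"
  by (simp_all add: excited_proj_def matrix_diff_ldistrib matrix_diff_rdistrib ground_proj_idem)

lemma reduced_resolvent:
  shows reduced_resolvent_M: "G ** M = Q0"
    and reduced_resolvent_ground: "G ** P0 = 0"
    and ground_reduced_resolvent: "P0 ** G = 0"
proof -
  obtain B where B: "B ** (M + P0) = mat 1" "(M + P0) ** B = mat 1"
    using invertible_M_plus_ground_proj by (auto simp: invertible_def)
  have "B ** P0 = B ** ((M + P0) ** P0)"
    by (simp add: matrix_add_rdistrib M_ground_proj ground_proj_idem)
  then have BP: "B ** P0 = P0" by (simp add: matrix_mul_assoc B(1))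
  have BM: "B ** M = Q0"
    using B(1) BP by (simp add: excited_proj_def matrix_add_ldistrib eq_diff_eq)
  have "(Q0 ** B) ** M = Q0" by (simp add: BM excited_proj_idem flip: matrix_mul_assoc)
  moreover have "(Q0 ** B) ** P0 = 0" by (simp add: BP excited_ground flip: matrix_mul_assoc)
  moreover have "P0 ** (Q0 ** B) = 0" by (simp add: ground_excited matrix_mul_assoc)
  moreover have "G' = Q0 ** B" if "G' ** M = Q0 \<and> G' ** P0 = 0 \<and> P0 ** G' = 0" for G'
  proof -
    have "G' = G' ** ((M + P0) ** B)" by (simp add: B(2))
    also have "\<dots> = Q0 ** B" using that by (simp add: matrix_mul_assoc matrix_add_ldistrib)
    finally show ?thesis .
  qed
  ultimately have "\<exists>!G'. G' ** M = Q0 \<and> G' ** P0 = 0 \<and> P0 ** G' = 0" by blast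
  then have "G ** M = Q0 \<and> G ** P0 = 0 \<and> P0 ** G = 0"
    unfolding reduced_resolvent_def by (rule theI')
  then show "G ** M = Q0" "G ** P0 = 0" "P0 ** G = 0" by auto
qed

lemma reduced_resolvent_power:
  assumes "m \<ge> 1"
  shows ground_reduced_resolvent_power: "P0 ** mpow G m = 0"
    and reduced_resolvent_power_ground: "mpow G m ** P0 = 0"
    and excited_reduced_resolvent_power: "Q0 ** mpow G m = mpow G m"
    and reduced_resolvent_power_excited: "mpow G m ** Q0 = mpow G m"
proof -
  obtain k where m: "m = Suc k" using assms by (cases m) auto
  have QG: "Q0 ** G = G" and GQ: "G ** Q0 = G"
    by (simp_all add: excited_proj_def matrix_diff_ldistrib matrix_diff_rdistrib
        reduced_resolvent_ground ground_reduced_resolvent)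
  show "P0 ** mpow G m = 0"
    unfolding m mpow.simps by (simp add: matrix_mul_assoc ground_reduced_resolvent)
  show "mpow G m ** P0 = 0"
    unfolding m mpow_Suc_right by (simp add: reduced_resolvent_ground flip: matrix_mul_assoc)
  show "Q0 ** mpow G m = mpow G m"
    unfolding m mpow.simps by (simp add: matrix_mul_assoc QG)
  show "mpow G m ** Q0 = mpow G m"
    unfolding m mpow_Suc_right by (simp add: GQ flip: matrix_mul_assoc)
qed

lemma reduced_resolvent_power_M_power: "mpow G (Suc k) ** mpow M (Suc k) = Q0"
proof (induction k)
  case (Suc k)
  have "mpow G (Suc (Suc k)) ** mpow M (Suc (Suc k)) = G ** (mpow G (Suc k) ** mpow M (Suc k)) ** M"
    by (simp only: mpow.simps(2)[of G "Suc k"] mpow_Suc_right[of M "Suc k"] matrix_mul_assoc)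
  then show ?case
    using Suc.IH reduced_resolvent_power_excited[of 1] by (simp add: reduced_resolvent_M)
qed (simp add: reduced_resolvent_M)

lemma excited_proj_eq_0_if_power:
  assumes "m \<ge> 1" and "mpow G m = 0"
  shows "Q0 = 0"
proof -
  obtain k where "m = Suc k" using assms(1) by (cases m) auto
  then show ?thesis using reduced_resolvent_power_M_power[of k] assms(2) by simp
qed

section \<open>The sets \<open>\<Gamma>(n)\<close> and \<open>\<Gamma>\<^sup>\<star>(n)\<close>\<close>

lemma Zset_cases: "Z \<in> Zset H \<Longrightarrow> Z = P0 \<or> Z = Q0 \<or> (\<exists>m\<ge>1. Z = mpow G m)"
  by (auto simp: Zset_def)

lemma Zset_mult:
  assumes "Z1 \<in> Zset H" and "Z2 \<in> Zset H"
  shows "Z1 ** Z2 \<in> Zset H \<or> Z1 ** Z2 = 0"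
  using Zset_cases[OF assms(1)] Zset_cases[OF assms(2)]
proof (elim disjE exE conjE)
  fix a b assume "a \<ge> 1" "Z1 = mpow G a" "b \<ge> 1" "Z2 = mpow G b"
  then show ?thesis by (auto simp: Zset_def mpow_add[symmetric])
qed (auto simp: Zset_def ground_proj_idem excited_proj reduced_resolvent_power)

lemma Zset_excited:
  assumes "Z \<in> Zset H" and "Z \<noteq> P0"
  shows "P0 ** Z = 0" and "Z ** P0 = 0"
  using Zset_cases[OF assms(1)] assms(2)
  by (auto simp: ground_excited excited_ground reduced_resolvent_power)

lemma Zset_excited_mult_eq_0:
  assumes "Z1 \<in> Zset H" "Z2 \<in> Zset H" "Z1 \<noteq> P0" "Z2 \<noteq> P0" and "Z1 ** Z2 = 0"
  shows "Q0 = 0"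
  using Zset_cases[OF assms(1)] Zset_cases[OF assms(2)] assms(3-5)
proof (elim disjE exE conjE)
  fix a b assume "a \<ge> 1" "Z1 = mpow G a" "b \<ge> 1" "Z2 = mpow G b" "Z1 ** Z2 = 0"
  then show ?thesis using excited_proj_eq_0_if_power[of "a + b"] by (simp add: mpow_add)
qed (auto simp: excited_proj_idem reduced_resolvent_power intro: excited_proj_eq_0_if_power)

lemma Gamma_mult:
  assumes "A \<in> Gamma H V a" and "B \<in> Gamma H V b"
  shows "A ** B \<in> Gamma H V (a + b)"
  using assms unfolding Gamma_def
proof (rule cspan_mult[rotated])
  fix x y
  assume "x \<in> {word_prod V Zs |Zs. length Zs = Suc a \<and> set Zs \<subseteq> Zset H}"
    and "y \<in> {word_prod V Zs |Zs. length Zs = Suc b \<and> set Zs \<subseteq> Zset H}"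
  then obtain Zs Ws where x: "x = word_prod V Zs" "length Zs = Suc a" "set Zs \<subseteq> Zset H"
    and y: "y = word_prod V Ws" "length Ws = Suc b" "set Ws \<subseteq> Zset H" by blast
  have ne: "Zs \<noteq> []" "Ws \<noteq> []" using x y by auto
  define Rs where "Rs = butlast Zs @ (last Zs ** hd Ws) # tl Ws"
  have xy: "x ** y = word_prod V Rs" using word_prod_mult[OF ne] x y by (simp add: Rs_def)
  have "last Zs ** hd Ws \<in> Zset H \<or> last Zs ** hd Ws = 0"
    using ne x y by (intro Zset_mult) auto
  moreover have "set Rs - {last Zs ** hd Ws} \<subseteq> Zset H"
    using ne x y by (auto simp: Rs_def dest: in_set_butlastD list.set_sel(2))
  ultimately have "set Rs \<subseteq> Zset H \<or> 0 \<in> set Rs" by (auto simp: Rs_def)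
  moreover have "length Rs = Suc (a + b)" using x y ne by (simp add: Rs_def)
  ultimately show "x ** y \<in> cspan {word_prod V Zs |Zs. length Zs = Suc (a + b) \<and> set Zs \<subseteq> Zset H}"
    using xy word_prod_eq_0[of Rs V] by (auto intro: cspan.intros)
qed

lemma mat_1_in_Gamma_0: "mat 1 \<in> Gamma H V 0"
proof -
  have "Z \<in> Gamma H V 0" if "Z \<in> Zset H" for Z
    using that unfolding Gamma_def by (intro cspan.base) (auto intro: exI[of _ "[Z]"])
  then have "P0 + Q0 \<in> Gamma H V 0" unfolding Gamma_def by (auto simp: Zset_def intro: cspan.add)
  then show ?thesis by (simp add: ground_plus_excited)
qed

lemma foldr_mult_in_Gamma:
  "list_all2 (\<lambda>T n. T \<in> Gamma H V n) Ts ns \<Longrightarrow> foldr (**) Ts (mat 1) \<in> Gamma H V (sum_list ns)"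
  by (induction Ts ns rule: list_all2_induct) (auto simp: mat_1_in_Gamma_0 Gamma_mult)

lemma word_prod_block_antidiagonal:
  assumes Zs: "set Zs \<subseteq> Zset H" "Zs \<noteq> []" and ends: "hd Zs ** last Zs = 0"
  shows "block_antidiagonal P0 (word_prod V Zs)"
proof -
  obtain X Y where X: "word_prod V Zs = hd Zs ** X" and Y: "word_prod V Zs = Y ** last Zs"
    using word_prod_hd[OF Zs(2)] word_prod_last[OF Zs(2)] by metis
  have hd: "hd Zs \<in> Zset H" and last: "last Zs \<in> Zset H" using Zs by auto
  have PX: "P0 ** word_prod V Zs = 0" if "hd Zs \<noteq> P0"
    using Zset_excited(1)[OF hd that] X by (simp add: matrix_mul_assoc)
  have YP: "word_prod V Zs ** P0 = 0" if "last Zs \<noteq> P0"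
    using Zset_excited(2)[OF last that] Y by (simp flip: matrix_mul_assoc)
  have "P0 ** word_prod V Zs ** P0 = 0"
  proof (cases "hd Zs = P0 \<and> last Zs = P0")
    case True
    then have "P0 = 0" using ends ground_proj_idem by simp
    then show ?thesis by simp
  next
    case False
    then show ?thesis using PX YP by (metis matrix_mul_assoc times0_left times0_right)
  qed
  moreover have "Q0 ** word_prod V Zs ** Q0 = 0"
  proof (cases "hd Zs = P0 \<or> last Zs = P0")
    case True
    then show ?thesis
      using X Y excited_ground ground_excited by (metis matrix_mul_assoc times0_left times0_right)
  next
    case False
    then have "Q0 = 0" using Zset_excited_mult_eq_0[OF hd last] ends by blast
    then show ?thesis by simp
  qed
  ultimately show ?thesis by (simp add: block_antidiagonal_def excited_proj_def)
qed

lemma Gamma_star_block_antidiagonal: "T \<in> Gamma_star H V n \<Longrightarrow> block_antidiagonal P0 T"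
  unfolding Gamma_star_def
  by (rule block_antidiagonal_cspan) (auto intro: word_prod_block_antidiagonal)

end

theorem lemma4:
  fixes H0 V :: "complex ^ 'n::finite ^ 'n" and L :: nat
  assumes "hermitian H0" and "hermitian V"
    and hyp: "\<forall>n < L. \<forall>T \<in> Gamma H0 V n. ground_proj H0 ** T ** ground_proj H0 \<in> CP0 H0"
  shows "\<forall>k \<ge> 1. \<forall>ns Ts. length ns = 2 * k \<and> length Ts = 2 * k
      \<and> sum_list ns < L \<and> (\<forall>j < 2 * k. Ts ! j \<in> Gamma_star H0 V (ns ! j))
      \<longrightarrow> foldr (**) Ts (mat 1) ** ground_proj H0 \<in> CP0 H0
        \<and> ground_proj H0 ** foldr (**) Ts (mat 1) \<in> CP0 H0"
proof (intro allI impI)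
  interpret hamiltonian H0 by unfold_locales (rule assms(1))
  fix k ns and Ts :: "'n cmat list"
  assume "length ns = 2 * k \<and> length Ts = 2 * k
      \<and> sum_list ns < L \<and> (\<forall>j < 2 * k. Ts ! j \<in> Gamma_star H0 V (ns ! j))"
  then have len: "length Ts = 2 * k" and "sum_list ns < L"
    and star: "list_all2 (\<lambda>T n. T \<in> Gamma_star H0 V n) Ts ns"
    by (auto simp: list_all2_conv_all_nth)
  let ?R = "foldr (**) Ts (mat 1)"
  have "list_all2 (\<lambda>T n. T \<in> Gamma H0 V n) Ts ns"
    using star by (rule list_all2_mono) (use Gamma_star_subset_Gamma in blast)
  then have "?R \<in> Gamma H0 V (sum_list ns)" by (rule foldr_mult_in_Gamma)
  then have "P0 ** ?R ** P0 \<in> CP0 H0" using hyp \<open>sum_list ns < L\<close> by blast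
  moreover have "\<forall>T \<in> set Ts. block_antidiagonal P0 T"
    using star Gamma_star_block_antidiagonal
    by (fastforce simp: list_all2_conv_all_nth in_set_conv_nth)
  then have "block_diagonal P0 ?R" using block_antidiagonal_foldr_mult[OF ground_proj_idem] len by simp
  ultimately show "?R ** P0 \<in> CP0 H0 \<and> P0 ** ?R \<in> CP0 H0"
    by (metis block_diagonal_projection_mult)
qed

end
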